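(* Let $\mathfrak{g}$ be a Lie algebra and $\mathcal{S}$ be a commutative and associative algebra with unit over $\mathbb{F}$. Assume that the current Lie algebra $\mathfrak{g}\otimes\mathcal{S}$ admits an invariant metric $\bar{B}$. Then $\mathfrak{g}$ admits an invariant metric if and only if there are a non-zero element $s\in\mathcal{S}$ and an ordered pair $(\psi_s,F)\in\operatorname{Hom}_{\mathbb{F}}(\mathfrak{g},\mathfrak{g}^{\ast})\times\operatorname{Hom}_{\mathbb{F}}(\mathfrak{g}\otimes\mathcal{S},\mathfrak{g})$ such that: (i) $F^{\ast}\circ\psi_s=\bar{B}^{\flat}\circ\iota_s$; (ii) $\psi_s(x)(y)=\psi_s(y)(x)$ for all $x,y\in\mathfrak{g}$; (iii) $F$ is surjective and satisfies $F([x\otimes t,y\otimes 1])=[F(x\otimes t),y]$ for all $x,y\in\mathfrak{g}$ and $t\in\mathcal{S}$.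
   Context: All algebras and vector spaces are finite-dimensional over a field $\mathbb{F}$ of characteristic zero. An invariant metric on a Lie algebra is a non-degenerate, symmetric bilinear form $B$ with $B(x,[y,z])=B([x,y],z)$ for all $x,y,z$. The current Lie algebra of $\mathfrak{g}$ by $\mathcal{S}$ is $\mathfrak{g}\otimes\mathcal{S}$ with bracket $[x\otimes s,y\otimes t]=[x,y]\otimes st$. For $s\in\mathcal{S}$, $\iota_s:\mathfrak{g}\to\mathfrak{g}\otimes\mathcal{S}$ is the linear map $\iota_s(x)=x\otimes s$. $\bar{B}^{\flat}:\mathfrak{g}\otimes\mathcal{S}\to(\mathfrak{g}\otimes\mathcal{S})^{\ast}$ is defined by $\bar{B}^{\flat}(u)(v)=\bar{B}(u,v)$. $F^{\ast}:\mathfrak{g}^{\ast}\to(\mathfrak{g}\otimes\mathcal{S})^{\ast}$ is the dual map of $F$. The subscript in $\psi_s$ merely records the associated element $s$. *)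

theory Defs
  imports Complex_Main "HOL-Library.Poly_Mapping" "HOL-Library.Function_Algebras"
begin

text \<open>A vector space over the field \<open>'f\<close> is a whole type with an explicit scalar multiplication, as
  in \<^theory>\<open>HOL.Vector_Spaces\<close>. All structures below are carried by such types.\<close>

definition bilinear_map ::
  "('f::field \<Rightarrow> 'a::ab_group_add \<Rightarrow> 'a) \<Rightarrow> ('f \<Rightarrow> 'b::ab_group_add \<Rightarrow> 'b) \<Rightarrow>
   ('f \<Rightarrow> 'c::ab_group_add \<Rightarrow> 'c) \<Rightarrow> ('a \<Rightarrow> 'b \<Rightarrow> 'c) \<Rightarrow> bool"
  where "bilinear_map sA sB sC f \<longleftrightarrow>
    (\<forall>x. Vector_Spaces.linear sB sC (f x)) \<and> (\<forall>y. Vector_Spaces.linear sA sC (\<lambda>x. f x y))"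

definition finite_dim :: "('f::field \<Rightarrow> 'a::ab_group_add \<Rightarrow> 'a) \<Rightarrow> bool"
  where "finite_dim scale \<longleftrightarrow> (\<exists>Basis. finite_dimensional_vector_space scale Basis)"

locale lie_algebra = vector_space scale
  for scale :: "'f::field_char_0 \<Rightarrow> 'g::ab_group_add \<Rightarrow> 'g" +
  fixes bracket :: "'g \<Rightarrow> 'g \<Rightarrow> 'g"
  assumes bracket_bilinear: "bilinear_map scale scale scale bracket"
    and bracket_self: "bracket x x = 0"
    and jacobi: "bracket x (bracket y z) + bracket y (bracket z x) + bracket z (bracket x y) = 0"

text \<open>Commutativity, associativity and the unit are those of the type class; it includes
  \<open>0 \<noteq> 1\<close>, so the zero algebra is not an algebra with unit here.\<close>

locale comm_unital_algebra = vector_space scale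
  for scale :: "'f::field_char_0 \<Rightarrow> 's::comm_ring_1 \<Rightarrow> 's" +
  assumes scale_mult_left: "scale a x * y = scale a (x * y)"


subsection \<open>Tensor products\<close>

definition free_scale :: "'f::field \<Rightarrow> ('i \<Rightarrow>\<^sub>0 'f) \<Rightarrow> ('i \<Rightarrow>\<^sub>0 'f)"
  where "free_scale c = Poly_Mapping.map ((*) c)"

definition free_extend ::
  "('f::field \<Rightarrow> 't::ab_group_add \<Rightarrow> 't) \<Rightarrow> ('i \<Rightarrow> 't) \<Rightarrow> ('i \<Rightarrow>\<^sub>0 'f) \<Rightarrow> 't"
  where "free_extend scale h p =
    (\<Sum>i \<in> Poly_Mapping.keys p. scale (Poly_Mapping.lookup p i) (h i))"

abbreviation free_gen :: "'i \<Rightarrow> ('i \<Rightarrow>\<^sub>0 'f::field)"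
  where "free_gen i \<equiv> Poly_Mapping.single i 1"

definition tensor_relations ::
  "('f::field \<Rightarrow> 'a::ab_group_add \<Rightarrow> 'a) \<Rightarrow> ('f \<Rightarrow> 'b::ab_group_add \<Rightarrow> 'b) \<Rightarrow> ('a \<times> 'b \<Rightarrow>\<^sub>0 'f) set"
  where "tensor_relations sA sB =
      {free_gen (x + x', y) - free_gen (x, y) - free_gen (x', y) | x x' y. True}
    \<union> {free_gen (x, y + y') - free_gen (x, y) - free_gen (x, y') | x y y'. True}
    \<union> {free_gen (sA c x, y) - free_scale c (free_gen (x, y)) | c x y. True}
    \<union> {free_gen (x, sB c y) - free_scale c (free_gen (x, y)) | c x y. True}"

text \<open>The usual construction of the tensor product is the quotient of the free vector space on
  \<open>A \<times> B\<close> by the span of the bilinearity relations. That quotient depends on the scalar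
  multiplications, so it is not a type constructor of HOL; instead \<open>'t\<close> is said to be the tensor
  product, with pure tensors \<open>tens x y\<close>, when the linear map sending the generator \<open>(x, y)\<close> to
  \<open>tens x y\<close> exhibits \<open>'t\<close> as this quotient.\<close>

definition is_tensor_product ::
  "('f::field \<Rightarrow> 'a::ab_group_add \<Rightarrow> 'a) \<Rightarrow> ('f \<Rightarrow> 'b::ab_group_add \<Rightarrow> 'b) \<Rightarrow>
   ('f \<Rightarrow> 't::ab_group_add \<Rightarrow> 't) \<Rightarrow> ('a \<Rightarrow> 'b \<Rightarrow> 't) \<Rightarrow> bool"
  where "is_tensor_product sA sB sT tens \<longleftrightarrow>
    vector_space sT \<and>
    surj (free_extend sT (case_prod tens)) \<and>
    {p. free_extend sT (case_prod tens) p = 0} = module.span free_scale (tensor_relations sA sB)"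

definition is_current_bracket ::
  "('f::field \<Rightarrow> 't::ab_group_add \<Rightarrow> 't) \<Rightarrow> ('g \<Rightarrow> 's::times \<Rightarrow> 't) \<Rightarrow> ('g \<Rightarrow> 'g \<Rightarrow> 'g) \<Rightarrow>
   ('t \<Rightarrow> 't \<Rightarrow> 't) \<Rightarrow> bool"
  where "is_current_bracket sT tens bracket bracketT \<longleftrightarrow>
    bilinear_map sT sT sT bracketT \<and>
    (\<forall>x y s t. bracketT (tens x s) (tens y t) = tens (bracket x y) (s * t))"


subsection \<open>Invariant metrics and duals\<close>

definition invariant_metric ::
  "('f::field \<Rightarrow> 'a::ab_group_add \<Rightarrow> 'a) \<Rightarrow> ('a \<Rightarrow> 'a \<Rightarrow> 'a) \<Rightarrow> ('a \<Rightarrow> 'a \<Rightarrow> 'f) \<Rightarrow> bool"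
  where "invariant_metric scale bracket B \<longleftrightarrow>
    bilinear_map scale scale (*) B \<and>
    (\<forall>x y. B x y = B y x) \<and>
    (\<forall>x. (\<forall>y. B x y = 0) \<longrightarrow> x = 0) \<and>
    (\<forall>x y z. B x (bracket y z) = B (bracket x y) z)"

definition dual_space :: "('f::field \<Rightarrow> 'a::ab_group_add \<Rightarrow> 'a) \<Rightarrow> ('a \<Rightarrow> 'f) set"
  where "dual_space scale = {\<phi>. Vector_Spaces.linear scale (*) \<phi>}"

definition hom_to_dual ::
  "('f::field \<Rightarrow> 'a::ab_group_add \<Rightarrow> 'a) \<Rightarrow> ('f \<Rightarrow> 'b::ab_group_add \<Rightarrow> 'b) \<Rightarrow> ('a \<Rightarrow> 'b \<Rightarrow> 'f) set"
  where "hom_to_dual sA sB =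
    {\<psi>. Vector_Spaces.linear sA (\<lambda>c \<phi> y. c * \<phi> y) \<psi> \<and> range \<psi> \<subseteq> dual_space sB}"

definition dual_map :: "('a \<Rightarrow> 'b) \<Rightarrow> ('b \<Rightarrow> 'f) \<Rightarrow> ('a \<Rightarrow> 'f)"
  where "dual_map F \<phi> = \<phi> \<circ> F"

definition flat :: "('a \<Rightarrow> 'a \<Rightarrow> 'f) \<Rightarrow> 'a \<Rightarrow> ('a \<Rightarrow> 'f)"
  where "flat B u = (\<lambda>v. B u v)"

definition iota :: "('g \<Rightarrow> 's \<Rightarrow> 't) \<Rightarrow> 's \<Rightarrow> 'g \<Rightarrow> 't"
  where "iota tens s x = tens x s"


subsection \<open>The tensor product and the current Lie algebra are well defined\<close>

lemma lookup_free_scale [simp]: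
  "Poly_Mapping.lookup (free_scale c p) i = c * Poly_Mapping.lookup p i"
  by (simp add: free_scale_def map.rep_eq when_def)

lemma vector_space_free_scale: "vector_space (free_scale :: 'f::field \<Rightarrow> ('i \<Rightarrow>\<^sub>0 'f) \<Rightarrow> _)"
  by unfold_locales (auto intro!: poly_mapping_eqI simp: lookup_add algebra_simps)

lemma free_extend_superset:
  assumes "vector_space sT" "finite I" "Poly_Mapping.keys p \<subseteq> I"
  shows "free_extend sT h p = (\<Sum>i\<in>I. sT (Poly_Mapping.lookup p i) (h i))"
proof -
  interpret vector_space sT by fact
  show ?thesis unfolding free_extend_def
    by (rule sum.mono_neutral_left) (use assms in \<open>auto simp: in_keys_iff\<close>)
qed

lemma linear_free_extend:
  fixes sT :: "'f::field \<Rightarrow> 't::ab_group_add \<Rightarrow> 't" and h :: "'i \<Rightarrow> 't"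
  assumes "vector_space sT"
  shows "Vector_Spaces.linear free_scale sT (free_extend sT h)"
proof -
  interpret T: vector_space sT by fact
  interpret P: vector_space "free_scale :: 'f \<Rightarrow> ('i \<Rightarrow>\<^sub>0 'f) \<Rightarrow> _" by (rule vector_space_free_scale)
  have add: "free_extend sT h (p + q) = free_extend sT h p + free_extend sT h q" for p q
  proof -
    let ?I = "Poly_Mapping.keys p \<union> Poly_Mapping.keys q"
    have "Poly_Mapping.keys (p + q) \<subseteq> ?I" by (rule Poly_Mapping.keys_add)
    then show ?thesis
      by (simp add: free_extend_superset[OF assms, of ?I] lookup_add T.scale_left_distrib
          sum.distrib)
  qed
  have scale: "free_extend sT h (free_scale c p) = sT c (free_extend sT h p)" for c p
  proof -
    have "Poly_Mapping.keys (free_scale c p) \<subseteq> Poly_Mapping.keys p"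
      by (auto simp: in_keys_iff)
    then show ?thesis
      by (simp add: free_extend_superset[OF assms, of "Poly_Mapping.keys p"] T.scale_sum_right)
  qed
  show ?thesis by unfold_locales (auto simp: add scale)
qed

lemma free_extend_gen [simp]:
  "vector_space sT \<Longrightarrow> free_extend sT h (free_gen i) = h i"
  by (simp add: free_extend_superset[of _ "{i}"] vector_space.vector_space_assms)

lemma bilinear_mapI:
  assumes "vector_space sA" "vector_space sB" "vector_space sC"
    "\<And>x x' y. f (x + x') y = f x y + f x' y" "\<And>x y y'. f x (y + y') = f x y + f x y'"
    "\<And>c x y. f (sA c x) y = sC c (f x y)" "\<And>c x y. f x (sB c y) = sC c (f x y)"
  shows "bilinear_map sA sB sC f"
  using assms by (auto simp: bilinear_map_def Vector_Spaces.linear_iff)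

lemma bilinear_mapD:
  assumes "bilinear_map sA sB sC f"
  shows "vector_space sA" "vector_space sB" "vector_space sC"
    "f (x + x') y = f x y + f x' y" "f x (y + y') = f x y + f x y'"
    "f (sA c x) y = sC c (f x y)" "f x (sB c y) = sC c (f x y)"
  using assms by (auto simp: bilinear_map_def Vector_Spaces.linear_iff)

lemma tensor_bilinear:
  assumes "vector_space sA" "vector_space sB" and T: "is_tensor_product sA sB sT tens"
  shows "bilinear_map sA sB sT tens"
proof -
  interpret P: vector_space "free_scale :: 'a \<Rightarrow> ('b \<times> 'c \<Rightarrow>\<^sub>0 'a) \<Rightarrow> _"
    by (rule vector_space_free_scale)
  have vT: "vector_space sT" using T by (simp add: is_tensor_product_def)
  interpret L: Vector_Spaces.linear free_scale sT "free_extend sT (case_prod tens)"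
    by (rule linear_free_extend[OF vT])
  have ker: "free_extend sT (case_prod tens) r = 0" if "r \<in> tensor_relations sA sB" for r
    using T P.span_base[OF that] unfolding is_tensor_product_def by blast
  show ?thesis
  proof (rule bilinear_mapI[OF assms(1,2) vT])
    fix x x' :: 'b and y y' :: 'c and c :: 'a
    note s = L.diff L.add L.scale free_extend_gen[OF vT] prod.case diff_diff_eq right_minus_eq
    have "free_gen (x + x', y) - free_gen (x, y) - free_gen (x', y) \<in> tensor_relations sA sB"
      unfolding tensor_relations_def by blast
    from ker[OF this] show "tens (x + x') y = tens x y + tens x' y" unfolding s .
    have "free_gen (x, y + y') - free_gen (x, y) - free_gen (x, y') \<in> tensor_relations sA sB"
      unfolding tensor_relations_def by blast
    from ker[OF this] show "tens x (y + y') = tens x y + tens x y'" unfolding s .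
    have "free_gen (sA c x, y) - free_scale c (free_gen (x, y)) \<in> tensor_relations sA sB"
      unfolding tensor_relations_def by blast
    from ker[OF this] show "tens (sA c x) y = sT c (tens x y)" unfolding s .
    have "free_gen (x, sB c y) - free_scale c (free_gen (x, y)) \<in> tensor_relations sA sB"
      unfolding tensor_relations_def by blast
    from ker[OF this] show "tens x (sB c y) = sT c (tens x y)" unfolding s .
  qed
qed

lemma tensor_induct:
  assumes "vector_space sA" "vector_space sB" and T: "is_tensor_product sA sB sT tens"
    and "\<And>x y. Q (tens x y)" "Q 0" "\<And>u v. Q u \<Longrightarrow> Q v \<Longrightarrow> Q (u + v)"
  shows "Q u"
proof -
  obtain p where p: "u = free_extend sT (case_prod tens) p"
    using T by (auto simp: is_tensor_product_def surj_def)
  have "Q (\<Sum>i\<in>I. sT (Poly_Mapping.lookup p i) (case_prod tens i))" if "finite I" for I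
    using that
  proof (induction I rule: finite_induct)
    case (insert i I)
    obtain x y where "i = (x, y)" by (cases i)
    then have "Q (sT (Poly_Mapping.lookup p i) (case_prod tens i))"
      using assms(4) by (simp flip: bilinear_mapD(6)[OF tensor_bilinear[OF assms(1-3)]])
    then show ?case using insert assms(6) by simp
  qed (simp add: assms(5))
  then show ?thesis unfolding p free_extend_def by simp
qed

lemma tensor_universal:
  assumes "vector_space sA" "vector_space sB" and T: "is_tensor_product sA sB sT tens"
    and b: "bilinear_map sA sB sC b"
  shows "\<exists>!f. Vector_Spaces.linear sT sC f \<and> (\<forall>x y. f (tens x y) = b x y)"
proof -
  let ?P = "free_scale :: 'a \<Rightarrow> ('b \<times> 'c \<Rightarrow>\<^sub>0 'a) \<Rightarrow> _"
  interpret P: vector_space ?P by (rule vector_space_free_scale)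
  have vT: "vector_space sT" using T by (simp add: is_tensor_product_def)
  have vC: "vector_space sC" by (rule bilinear_mapD(3)[OF b])
  define q where "q = free_extend sT (case_prod tens)"
  define g where "g = free_extend sC (case_prod b)"
  interpret q: Vector_Spaces.linear ?P sT q unfolding q_def by (rule linear_free_extend[OF vT])
  interpret g: Vector_Spaces.linear ?P sC g unfolding g_def by (rule linear_free_extend[OF vC])
  have "g r = 0" if "r \<in> tensor_relations sA sB" for r
    using that unfolding tensor_relations_def
    by (auto simp: g.diff g.scale) (simp_all add: g_def free_extend_gen[OF vC] bilinear_mapD[OF b])
  then have g0: "g p = 0" if "p \<in> P.span (tensor_relations sA sB)" for p
    using g.eq_0_on_span that by blast
  have gq: "g p = g p'" if "q p = q p'" for p p'
  proof -
    have "p - p' \<in> {r. q r = 0}" using that by (simp add: q.diff)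
    also have "\<dots> = P.span (tensor_relations sA sB)"
      using T unfolding is_tensor_product_def q_def by blast
    finally show ?thesis using g0[of "p - p'"] by (simp add: g.diff)
  qed
  define f where "f u = g (inv q u)" for u
  have surj: "surj q" using T by (simp add: is_tensor_product_def q_def)
  have fq: "f (q p) = g p" for p
    unfolding f_def by (rule gq) (simp add: surj surj_f_inv_f)
  have "f (u + v) = f u + f v \<and> f (sT c u) = sC c (f u)" for c u v
  proof -
    obtain p p' where [simp]: "u = q p" "v = q p'" using surj by (meson surjD)
    show ?thesis by (simp add: fq g.add g.scale flip: q.add q.scale)
  qed
  then have lin: "Vector_Spaces.linear sT sC f"
    using vT vC by (simp add: Vector_Spaces.linear_iff)
  have tens: "f (tens x y) = b x y" for x y
    using fq[of "free_gen (x, y)"] by (simp add: q_def g_def vT vC)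
  show ?thesis
  proof (rule ex1I)
    show "Vector_Spaces.linear sT sC f \<and> (\<forall>x y. f (tens x y) = b x y)" using lin tens by blast
    fix f' assume f': "Vector_Spaces.linear sT sC f' \<and> (\<forall>x y. f' (tens x y) = b x y)"
    interpret f: Vector_Spaces.linear sT sC f by (rule lin)
    interpret f': Vector_Spaces.linear sT sC f' using f' by blast
    have "f' u = f u" for u
      by (rule tensor_induct[OF assms(1-3)]) (use f' tens in \<open>auto simp: f.add f'.add f.zero f'.zero\<close>)
    then show "f' = f" by blast
  qed
qed

lemma current_bracket_ex1:
  assumes "lie_algebra sG bracket" "comm_unital_algebra sS"
    and T: "is_tensor_product sG sS sT tens"
  shows "\<exists>!bracketT. is_current_bracket sT tens bracket bracketT"
proof -
  interpret G: lie_algebra sG bracket by fact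
  interpret S: comm_unital_algebra sS by fact
  note vG = G.vector_space_axioms and vS = S.vector_space_axioms
  have vT: "vector_space sT" using T by (simp add: is_tensor_product_def)
  note tb = bilinear_mapD[OF tensor_bilinear[OF vG vS T]] and
    br = bilinear_mapD[OF G.bracket_bilinear]
  have scale_r: "t * sS c u = sS c (t * u)" for t c u
    using S.scale_mult_left[of c u t] by (simp add: mult.commute)
  note alg = tb br S.scale_mult_left scale_r distrib_left distrib_right
  have "\<forall>x s. \<exists>!f. Vector_Spaces.linear sT sT f \<and> (\<forall>y t. f (tens y t) = tens (bracket x y) (s * t))"
    by (intro allI tensor_universal[OF vG vS T] bilinear_mapI vG vS vT) (simp_all add: alg)
  then obtain f where f: "\<And>x s. Vector_Spaces.linear sT sT (f x s)"
    and ft: "\<And>x s y t. f x s (tens y t) = tens (bracket x y) (s * t)"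
    by metis
  note fl = f[unfolded Vector_Spaces.linear_iff]
  have ev: "Vector_Spaces.linear sT sT h \<Longrightarrow> h (u + v) = h u + h v" for h u v
    by (simp add: Vector_Spaces.linear_iff)
  interpret T: vector_space sT by (rule vT)
  have f0: "f x s 0 = 0" for x s
    using ev[OF f, of x s 0 0] by simp
  have "bilinear_map sG sS sT (\<lambda>x s. f x s v)" for v
  proof (intro bilinear_mapI vG vS vT)
    fix x x' s s' c
    show "f (x + x') s v = f x s v + f x' s v"
      by (rule tensor_induct[OF vG vS T, where u = v]) (simp_all add: f0 ft alg ev[OF f] algebra_simps)
    show "f x (s + s') v = f x s v + f x s' v"
      by (rule tensor_induct[OF vG vS T, where u = v]) (simp_all add: f0 ft alg ev[OF f])
    show "f (sG c x) s v = sT c (f x s v)"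
      by (rule tensor_induct[OF vG vS T, where u = v])
        (simp_all add: f0 ft alg ev[OF f] T.scale_right_distrib)
    show "f x (sS c s) v = sT c (f x s v)"
      by (rule tensor_induct[OF vG vS T, where u = v])
        (simp_all add: f0 ft alg ev[OF f] T.scale_right_distrib)
  qed
  then have "\<forall>v. \<exists>!h. Vector_Spaces.linear sT sT h \<and> (\<forall>x s. h (tens x s) = f x s v)"
    by (intro allI tensor_universal[OF vG vS T]) auto
  then obtain h where h: "\<And>v. Vector_Spaces.linear sT sT (h v)"
    and ht: "\<And>v x s. h v (tens x s) = f x s v"
    by metis
  have h0: "h v 0 = 0" for v
    using ev[OF h, of v 0 0] by simp
  have "is_current_bracket sT tens bracket (\<lambda>u v. h v u)"
    unfolding is_current_bracket_def
  proof (intro conjI allI bilinear_mapI vT)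
    fix u v w c
    show "h w (u + v) = h w u + h w v" by (rule ev[OF h])
    show "h w (sT c u) = sT c (h w u)" using h by (simp add: Vector_Spaces.linear_iff)
    show "h (v + w) u = h v u + h w u"
      by (rule tensor_induct[OF vG vS T, where u = u]) (simp_all add: h0 ht ev[OF h] ev[OF f])
    show "h (sT c v) u = sT c (h v u)"
      by (rule tensor_induct[OF vG vS T, where u = u])
        (use fl in \<open>simp_all add: h0 ht ev[OF h] T.scale_right_distrib\<close>)
  qed (simp add: ht ft)
  moreover have "b1 = b2"
    if b1: "is_current_bracket sT tens bracket b1" and b2: "is_current_bracket sT tens bracket b2"
    for b1 b2
  proof -
    note b1' = bilinear_mapD[OF b1[unfolded is_current_bracket_def, THEN conjunct1]]
    note b2' = bilinear_mapD[OF b2[unfolded is_current_bracket_def, THEN conjunct1]]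
    have z: "b1 u 0 = 0" "b1 0 u = 0" "b2 u 0 = 0" "b2 0 u = 0" for u
      using b1'(4)[of 0 0 u] b2'(4)[of 0 0 u] b1'(5)[of u 0 0] b2'(5)[of u 0 0] by auto
    have t: "b1 (tens x s) v = b2 (tens x s) v" for x s v
      by (rule tensor_induct[OF vG vS T, where u = v])
        (use b1 b2 in \<open>simp_all add: is_current_bracket_def z b1' b2'\<close>)
    have "b1 u v = b2 u v" for u v
      by (rule tensor_induct[OF vG vS T, where u = u]) (simp_all add: t z b1' b2')
    then show ?thesis by blast
  qed
  ultimately show ?thesis by blast
qed

end

theory Submission
  imports Defs
begin

text \<open>Both directions rest on the rule \<open>B x [y, z] = B [z, x] y\<close>, valid for every invariant metric.
  A metric \<open>B\<close> on \<open>\<gg>\<close> yields, for \<open>s = 1\<close>, the pair where \<open>\<psi>\<close> is the flat map of \<open>B\<close> and \<open>F\<close> is the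
  adjoint of \<open>x \<mapsto> x \<otimes> s\<close> with respect to \<open>B\<close> and the metric on the current algebra; \<open>F\<close> is surjective
  since \<open>x \<mapsto> x \<otimes> s\<close> is injective. Conversely \<open>\<psi>\<close> itself is the metric: nondegeneracy comes from this
  injectivity, and invariance from writing the elements of \<open>\<gg>\<close> as values of \<open>F\<close>.\<close>

text \<open>Invariance moves the bracket to the left, symmetry swaps the two arguments, and
  invariance applies once more.\<close>

lemma invariant_metric_cyclic:
  assumes "invariant_metric sA br B"
  shows "B x (br y z) = B (br z x) y"
  using assms unfolding invariant_metric_def by metis

lemma vector_space_times: "vector_space ((*) :: 'f::field \<Rightarrow> 'f \<Rightarrow> 'f)"
  by unfold_locales (auto simp: algebra_simps)

lemma vector_space_fun: "vector_space (\<lambda>(c::'f::field) \<phi> (y::'a). c * \<phi> y)"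
  by unfold_locales (auto simp: algebra_simps plus_fun_def)

text \<open>A basis of \<open>W\<close> stays independent when \<open>a\<close> is added, so the
  values 1 at \<open>a\<close> and 0 on that basis extend linearly.\<close>

lemma functional_separates:
  assumes "vector_space (sA :: 'f::field \<Rightarrow> 'a::ab_group_add \<Rightarrow> 'a)"
    and "module.subspace sA W" and "a \<notin> W"
  shows "\<exists>\<phi>. Vector_Spaces.linear sA (*) \<phi> \<and> \<phi> a = 1 \<and> (\<forall>w\<in>W. \<phi> w = 0)"
proof -
  interpret A: vector_space sA by fact
  interpret P: vector_space_pair sA "(*) :: 'f \<Rightarrow> 'f \<Rightarrow> 'f"
    using assms(1) vector_space_times by (rule vector_space_pair.intro)
  obtain C where C: "C \<subseteq> W" "A.independent C" "W \<subseteq> A.span C"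
    using A.maximal_independent_subset by blast
  have W: "A.span C = W"
    using C assms(2) by (metis A.span_mono A.span_eq_iff subset_antisym)
  have "a \<notin> A.span C"
    using assms(3) W by simp
  then have "A.independent (insert a C)"
    using C(2) by (rule A.independent_insertI)
  then obtain \<phi> where \<phi>: "Vector_Spaces.linear sA (*) \<phi>"
    "\<forall>x\<in>insert a C. \<phi> x = (if x = a then 1 else 0)"
    using P.linear_independent_extend[of "insert a C" "\<lambda>x. if x = a then 1 else 0"] by blast
  interpret \<phi>: Vector_Spaces.linear sA "(*)" \<phi> by (rule \<phi>(1))
  have "\<phi> w = 0" if "w \<in> W" for w
    by (rule \<phi>.eq_0_on_span[of C]) (use that \<phi>(2) W C(1) assms(3) in auto)
  then show ?thesis
    using \<phi> by auto
qed

text \<open>A functional \<open>\<sigma>\<close> with \<open>\<sigma> s = 1\<close> gives the linear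
  map sending \<open>tens x t\<close> to \<open>sA (\<sigma> t) x\<close>, a left inverse of
  \<open>\<lambda>x. tens x s\<close>.\<close>

lemma tensor_eq_0D:
  assumes "vector_space sA" "vector_space sB" "is_tensor_product sA sB sT tens"
    and "tens x s = 0" and "s \<noteq> 0"
  shows "x = 0"
proof -
  interpret A: vector_space sA by fact
  interpret B: vector_space sB by fact
  obtain \<sigma> where \<sigma>: "Vector_Spaces.linear sB (*) \<sigma>" "\<sigma> s = 1"
    using functional_separates[OF assms(2) B.subspace_single_0] \<open>s \<noteq> 0\<close> by blast
  interpret \<sigma>: Vector_Spaces.linear sB "(*)" \<sigma> by (rule \<sigma>(1))
  have "bilinear_map sA sB sA (\<lambda>x t. sA (\<sigma> t) x)"
    by (rule bilinear_mapI[OF assms(1,2,1)])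
      (simp_all add: \<sigma>.add \<sigma>.scale A.scale_right_distrib A.scale_left_distrib mult.commute)
  then obtain f where f: "Vector_Spaces.linear sT sA f" "\<And>x t. f (tens x t) = sA (\<sigma> t) x"
    using tensor_universal[OF assms(1-3)] by blast
  interpret f: Vector_Spaces.linear sT sA f by (rule f(1))
  show ?thesis
    using f(2)[of x s] \<sigma>(2) assms(4) by (simp add: f.zero)
qed

text \<open>The map from \<open>w\<close> to the functional \<open>\<lambda>x. B x w\<close> is
  injective by nondegeneracy, hence onto the dual by equality of finite dimensions.\<close>

lemma nondegenerate_represents:
  assumes "finite_dim sA" and B: "bilinear_map sA sA (*) B"
    and sym: "\<And>x y. B x y = B y x" and nondeg: "\<And>x. (\<And>y. B x y = 0) \<Longrightarrow> x = 0"
    and \<phi>: "Vector_Spaces.linear sA (*) \<phi>"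
  shows "\<exists>w. \<forall>x. B x w = \<phi> x"
proof -
  obtain E where "finite_dimensional_vector_space sA E"
    using assms(1) by (auto simp: finite_dim_def)
  then interpret A: finite_dimensional_vector_space sA E .
  interpret \<phi>: Vector_Spaces.linear sA "(*)" \<phi> by (rule \<phi>)
  note b = bilinear_mapD[OF B]
  have ext: "f = g" if "Vector_Spaces.linear sA (*) f" "Vector_Spaces.linear sA (*) g"
    "\<And>e. e \<in> E \<Longrightarrow> f e = g e" for f g
  proof
    interpret P: vector_space_pair sA "(*)"
      using b(1,3) by (rule vector_space_pair.intro)
    show "f x = g x" for x
      by (rule P.linear_eq_on_span[OF that(1,2), of E]) (simp_all add: that(3) A.span_Basis)
  qed
  have lin: "Vector_Spaces.linear sA (*) (\<lambda>x. B x w)" for w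
    using B by (simp add: bilinear_map_def)
  have coeff: "f e = g e" if eq: "(\<Sum>e\<in>E. sA (f e) e) = (\<Sum>e\<in>E. sA (g e) e)" and e: "e \<in> E" for f g e
  proof -
    have "(\<Sum>e\<in>E. sA (f e - g e) e) = 0"
      using eq by (simp add: A.scale_left_diff_distrib sum_subtractf)
    then show ?thesis
      using A.independentD[OF A.independent_Basis A.finite_Basis order_refl, of "\<lambda>e. f e - g e" e] e
      by simp
  qed
  \<comment> \<open>A functional is coded by the vector whose coordinates in the basis
    \<open>E\<close> are its values on \<open>E\<close>. This makes \<open>T\<close> an
    endomorphism, for which injectivity gives surjectivity.\<close>
  define T where "T w = (\<Sum>e\<in>E. sA (B e w) e)" for w
  have linT: "Vector_Spaces.linear sA sA T"
    by (simp add: Vector_Spaces.linear_iff b(1) T_def b A.scale_left_distrib sum.distrib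
        A.scale_sum_right)
  interpret T: Vector_Spaces.linear sA sA T by (rule linT)
  have "inj T"
    unfolding T.inj_iff_eq_0
  proof (intro allI impI nondeg)
    fix w y assume "T w = 0"
    then have "B e w = 0" if "e \<in> E" for e
      using coeff[of "\<lambda>e. B e w" "\<lambda>_. 0"] that by (simp add: T_def)
    then have "(\<lambda>x. B x w) = (\<lambda>_. 0)"
      using lin b(1,3) by (intro ext) (auto simp: Vector_Spaces.linear_iff)
    then show "B w y = 0"
      using sym by metis
  qed
  then have "surj T"
    by (rule A.linear_inj_imp_surj[OF linT])
  then obtain w where "(\<Sum>e\<in>E. sA (\<phi> e) e) = T w"
    by (rule surjE)
  then have "(\<lambda>x. B x w) = \<phi>"
    using lin \<phi> by (intro ext) (auto simp: T_def intro!: coeff)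
  then show ?thesis
    by metis
qed

theorem theorem3p2:
  fixes scaleG :: "'f::field_char_0 \<Rightarrow> 'g::ab_group_add \<Rightarrow> 'g"
    and bracketG :: "'g \<Rightarrow> 'g \<Rightarrow> 'g"
    and scaleS :: "'f \<Rightarrow> 's::comm_ring_1 \<Rightarrow> 's"
    and scaleT :: "'f \<Rightarrow> 't::ab_group_add \<Rightarrow> 't"
    and tens :: "'g \<Rightarrow> 's \<Rightarrow> 't"
    and bracketT :: "'t \<Rightarrow> 't \<Rightarrow> 't"
    and Bbar :: "'t \<Rightarrow> 't \<Rightarrow> 'f"
  assumes "lie_algebra scaleG bracketG" and "finite_dim scaleG"
    and "comm_unital_algebra scaleS" and "finite_dim scaleS"
    and "is_tensor_product scaleG scaleS scaleT tens"
    and "is_current_bracket scaleT tens bracketG bracketT"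
    and "invariant_metric scaleT bracketT Bbar"
  shows "(\<exists>B. invariant_metric scaleG bracketG B) \<longleftrightarrow>
    (\<exists>s \<psi> F. s \<noteq> 0 \<and> \<psi> \<in> hom_to_dual scaleG scaleG \<and> Vector_Spaces.linear scaleT scaleG F \<and>
      dual_map F \<circ> \<psi> = flat Bbar \<circ> iota tens s \<and>
      (\<forall>x y. \<psi> x y = \<psi> y x) \<and>
      surj F \<and>
      (\<forall>x y t. F (bracketT (tens x t) (tens y 1)) = bracketG (F (tens x t)) y))"
proof -
  interpret G: lie_algebra scaleG bracketG by fact
  interpret S: comm_unital_algebra scaleS by fact
  note vG = G.vector_space_axioms and vS = S.vector_space_axioms
  have vT: "vector_space scaleT"
    using assms(5) by (simp add: is_tensor_product_def)
  interpret T: vector_space scaleT by (rule vT)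
  note tb = bilinear_mapD[OF tensor_bilinear[OF vG vS assms(5)]]
  have bT: "bilinear_map scaleT scaleT scaleT bracketT"
    and tT: "\<And>x y s t. bracketT (tens x s) (tens y t) = tens (bracketG x y) (s * t)"
    using assms(6) by (auto simp: is_current_bracket_def)
  note bT' = bilinear_mapD[OF bT] and bG' = bilinear_mapD[OF G.bracket_bilinear]
  have bB: "bilinear_map scaleT scaleT (*) Bbar"
    and nondegT: "\<And>u. (\<And>v. Bbar u v = 0) \<Longrightarrow> u = 0"
    using assms(7) by (auto simp: invariant_metric_def)
  note bB' = bilinear_mapD[OF bB]
  \<comment> \<open>After the cyclic rule the bracket is that of \<open>tens z 1\<close> with
    \<open>tens x s\<close>; the unit leaves the factor \<open>s\<close> unchanged.\<close>
  have cycT: "Bbar (tens x s) (bracketT v (tens z 1)) = Bbar (tens (bracketG z x) s) v" for x s v z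
    using invariant_metric_cyclic[OF assms(7)] by (simp add: tT)
  show ?thesis
  proof
    assume "\<exists>B. invariant_metric scaleG bracketG B"
    then obtain B where B: "invariant_metric scaleG bracketG B" ..
    then have bil: "bilinear_map scaleG scaleG (*) B"
      and sym: "\<And>x y. B x y = B y x" and nondeg: "\<And>x. (\<And>y. B x y = 0) \<Longrightarrow> x = 0"
      by (auto simp: invariant_metric_def)
    note b = bilinear_mapD[OF bil]
    have represents: "\<exists>w. \<forall>x. B x w = \<phi> x" if "Vector_Spaces.linear scaleG (*) \<phi>" for \<phi>
      using sym nondeg that by (rule nondegenerate_represents[OF assms(2) bil])
    \<comment> \<open>The representing vector will be \<open>F v\<close>, so \<open>F\<close> is the
      adjoint of \<open>\<lambda>x. tens x 1\<close>.\<close>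
    have "\<exists>w. \<forall>x. B x w = Bbar (tens x 1) v" for v
      by (rule represents) (simp_all add: Vector_Spaces.linear_iff vG vector_space_times tb bB')
    then obtain F where F: "\<And>x v. B x (F v) = Bbar (tens x 1) v"
      by metis
    have eqI: "w = w'" if "\<And>x. B x w = B x w'" for w w'
    proof -
      have "B (w - w') x = 0" for x
        using that[of x] b(4)[of "w - w'" w' x] by (simp add: sym)
      then show ?thesis
        using nondeg[of "w - w'"] by simp
    qed
    have linF: "Vector_Spaces.linear scaleT scaleG F"
      unfolding Vector_Spaces.linear_iff
      by (intro conjI allI vT vG eqI) (simp_all add: F b bB')
    interpret F: Vector_Spaces.linear scaleT scaleG F by (rule linF)
    have "surj F"
    proof (rule ccontr)
      assume "\<not> surj F"
      then obtain a where a: "a \<notin> range F" by blast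
      have "G.subspace (range F)"
        using F.subspace_image T.subspace_UNIV by blast
      \<comment> \<open>The vector \<open>w\<close> representing a functional that kills
        \<open>range F\<close> makes \<open>tens w 1\<close> orthogonal to everything, so
        \<open>w = 0\<close>, against \<open>\<phi> a = 1\<close>.\<close>
      from functional_separates[OF vG this a] obtain \<phi> where \<phi>:
        "Vector_Spaces.linear scaleG (*) \<phi>" "\<phi> a = 1" "\<And>v. \<phi> (F v) = 0"
        by blast
      obtain w where w: "\<And>x. B x w = \<phi> x"
        using represents[OF \<phi>(1)] by blast
      have "Bbar (tens w 1) v = 0" for v
        using w \<phi>(3) F sym by metis
      then have "w = 0"
        using nondegT tensor_eq_0D[OF vG vS assms(5)] one_neq_zero by blast
      moreover have "B a 0 = 0"
        using b(5)[of a 0 0] by simp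
      ultimately show False
        using w[of a] \<phi>(2) by simp
    qed
    \<comment> \<open>Paired with \<open>x\<close>, both sides become
      \<open>Bbar (tens (bracketG y x) 1) v\<close>.\<close>
    moreover have "F (bracketT v (tens y 1)) = bracketG (F v) y" for v y
      by (rule eqI) (simp add: F cycT invariant_metric_cyclic[OF B])
    moreover have "B \<in> hom_to_dual scaleG scaleG"
      using bil by (auto simp: hom_to_dual_def dual_space_def bilinear_map_def
          Vector_Spaces.linear_iff vector_space_fun plus_fun_def fun_eq_iff)
    moreover have "dual_map F \<circ> B = flat Bbar \<circ> iota tens 1"
      by (auto simp: dual_map_def flat_def iota_def F fun_eq_iff)
    ultimately show "\<exists>s \<psi> F. s \<noteq> 0 \<and> \<psi> \<in> hom_to_dual scaleG scaleG \<and>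
      Vector_Spaces.linear scaleT scaleG F \<and> dual_map F \<circ> \<psi> = flat Bbar \<circ> iota tens s \<and>
      (\<forall>x y. \<psi> x y = \<psi> y x) \<and> surj F \<and>
      (\<forall>x y t. F (bracketT (tens x t) (tens y 1)) = bracketG (F (tens x t)) y)"
      using linF sym by (intro exI[of _ 1] exI[of _ B] exI[of _ F]) auto
  next
    assume "\<exists>s \<psi> F. s \<noteq> 0 \<and> \<psi> \<in> hom_to_dual scaleG scaleG \<and>
      Vector_Spaces.linear scaleT scaleG F \<and> dual_map F \<circ> \<psi> = flat Bbar \<circ> iota tens s \<and>
      (\<forall>x y. \<psi> x y = \<psi> y x) \<and> surj F \<and>
      (\<forall>x y t. F (bracketT (tens x t) (tens y 1)) = bracketG (F (tens x t)) y)"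
    then obtain s \<psi> F where s: "s \<noteq> 0" and \<psi>: "\<psi> \<in> hom_to_dual scaleG scaleG"
      and linF: "Vector_Spaces.linear scaleT scaleG F"
      and "dual_map F \<circ> \<psi> = flat Bbar \<circ> iota tens s"
      and sym: "\<And>x y. \<psi> x y = \<psi> y x" and surj: "surj F"
      and hom: "\<And>x y t. F (bracketT (tens x t) (tens y 1)) = bracketG (F (tens x t)) y"
      by blast
    then have F: "\<psi> x (F v) = Bbar (tens x s) v" for x v
      by (simp add: dual_map_def flat_def iota_def fun_eq_iff)
    interpret F: Vector_Spaces.linear scaleT scaleG F by (rule linF)
    have b0: "bracketT 0 u = 0" "bracketG 0 y = 0" for u y
      using bT'(4)[of 0 0 u] bG'(4)[of 0 0 y] by simp_all
    \<comment> \<open>Surjectivity of \<open>F\<close> yields preimages that need not be pure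
      tensors, so the identity is extended additively to every \<open>v\<close>.\<close>
    have hom': "F (bracketT v (tens y 1)) = bracketG (F v) y" for v y
      by (rule tensor_induct[OF vG vS assms(5), where u = v])
        (simp_all add: hom b0 F.zero F.add bT' bG')
    have "bilinear_map scaleG scaleG (*) \<psi>"
      using \<psi> by (auto simp: hom_to_dual_def dual_space_def bilinear_map_def
          Vector_Spaces.linear_iff vector_space_times plus_fun_def image_subset_iff)
    \<comment> \<open>If \<open>\<psi> x\<close> vanishes, then
      \<open>Bbar (tens x s) v = \<psi> x (F v) = 0\<close> for every \<open>v\<close>.\<close>
    moreover have "x = 0" if "\<And>y. \<psi> x y = 0" for x
    proof -
      have "tens x s = 0"
        by (rule nondegT) (simp add: that flip: F)
      then show ?thesis
        using tensor_eq_0D[OF vG vS assms(5) _ s] by blast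
    qed
    moreover have "\<psi> x (bracketG y z) = \<psi> (bracketG x y) z" for x y z
    proof -
      \<comment> \<open>With \<open>y = F v\<close>, the bracket is pulled inside \<open>F\<close>,
        so that \<open>cycT\<close> applies in the current algebra; the result is read back through
        \<open>F\<close>.\<close>
      have cyc: "\<psi> x (bracketG y z) = \<psi> (bracketG z x) y" for x y z
      proof -
        obtain v where "y = F v"
          using surj by (rule surjE)
        then show ?thesis
          by (simp add: F cycT flip: hom')
      qed
      \<comment> \<open>Two cyclic shifts with a symmetry between them: \<open>\<psi> x [y, z] =
        \<psi> [z, x] y = \<psi> y [z, x] = \<psi> [x, y] z\<close>.\<close>
      show ?thesis
        using cyc sym by metis
    qed
    ultimately have "invariant_metric scaleG bracketG \<psi>"
      unfolding invariant_metric_def using sym by blast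
    then show "\<exists>B. invariant_metric scaleG bracketG B"
      by blast
  qed
qed

end
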